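(* Let $C,\beta\ge1$, let $\varepsilon\in(0,\frac12)$, and let $W_n$ be the weighted diamonds with parameter $\varepsilon$. Let $\{d_n\}$ be any sequence of positive integers with $d_n=O((\log n)^2)$ (equivalently $O((\log\log|W_n|)^2)$). Let $\mathcal{E}$ be the class of all finite equilateral spaces, let $\mathcal{L}_{n,C}$ be the class of all finite metric spaces that admit an embedding into the $d_n$-dimensional Euclidean space with distortion $\le C$, and let $\mathcal{M}_{n,C}=\mathcal{E}\cup\mathcal{L}_{n,C}$. Then the spaces $W_n$ do not admit embeddings with uniformly bounded distortion into metric spaces from $\operatorname{comp}_\beta(\mathcal{M}_{n,C})$; that is, there is no constant $K$ such that for every $n$ there exists $V_n\in\operatorname{comp}_\beta(\mathcal{M}_{n,C})$ for which $W_n$ admits an embedding into $V_n$ with distortion at most $K$.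
   Context: Diamond graphs $\{D_n\}_{n\ge0}$: $D_0$ consists of two vertices joined by an edge; $D_n$ is obtained from $D_{n-1}$ by replacing each edge $uv$ of $D_{n-1}$ by a quadrilateral $u,a,v,b$ with two new vertices $a,b$ and edges $ua, av, vb, bu$. Weighted diamonds: for $\varepsilon\in(0,\frac12)$, $W_n$ is the weighted graph whose vertex set is the vertex set of $D_n$ and whose edge set is the union of the edge sets of $D_0,\dots,D_n$, where each edge of $D_i$ has weight $\left(\frac12+\varepsilon\right)^i$; $W_n$ is endowed with its weighted shortest path distance. $|W_n|$ is the number of vertices of $W_n$ (for $n\ge2$, $2n-1\le\log_2|W_n|<2n$). A metric space is equilateral if all distances between distinct points equal the same positive number. The distortion of an injective map $f:X\to Y$ is $\sup_{x\ne y}\frac{d_Y(f(x),f(y))}{d_X(x,y)}\cdot\sup_{x\ne y}\frac{d_X(x,y)}{d_Y(f(x),f(y))}$. Metric composition: let $M$ be a finite metric space, $\mathcal{N}=\{N_x\}_{x\in M}$ a collection of disjoint finite metric spaces, and $\beta\ge 1/2$. The $\beta$-composition $M_\beta[\mathcal{N}]$ is the disjoint union of the sets $N_x$ with the distance: for $u\in N_x$, $v\in N_y$, $d_\beta(u,v)=d_{N_x}(u,v)$ if $x=y$, and $d_\beta(u,v)=\beta\gamma\, d_M(x,y)$ if $x\neq y$, where $\gamma=\frac{\max_{z\in M}\operatorname{diam}(N_z)}{\min_{x\ne y\in M}d_M(x,y)}$. The composition is understood only for data for which this is a metric, i.e. $\gamma>0$; if $M$ has a single point $x$, then $M_\beta[\mathcal{N}]$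 is $N_x$. For a class $\mathcal{M}$ of finite metric spaces and $\beta\ge 1$, $\operatorname{comp}_\beta(\mathcal{M})$ is the smallest class $\mathcal{C}$ of metric spaces that contains all spaces in $\mathcal{M}$ and satisfies: whenever $M\in\mathcal{M}$, $\beta'\ge\beta$, and with every $x\in M$ there is associated a metric space $N_x$ isometric to a space in $\mathcal{C}$, the space $M_{\beta'}[\{N_x\}_{x\in M}]$ is also in $\mathcal{C}$. *)

theory Defs
  imports
    "HOL-Analysis.Analysis"
    "HOL-Library.Uprod"
    "HOL-Library.Landau_Symbols"
    "Graph_Theory.Graph_Theory"
begin

section \<open>Diamond graphs\<close>

text \<open>
  Undirected graphs are symmetric digraphs, as in the graph library.  The two vertices that
  replace the edge $uv$ are \<open>New (Upair u v) False\<close> and \<open>New (Upair u v) True\<close>; lemma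
  \<open>diamond_fresh\<close> below shows that they are indeed new.
\<close>

datatype dvertex = Pole bool | New "dvertex uprod" bool

primrec diamond :: "nat \<Rightarrow> dvertex pair_pre_digraph" where
  "diamond 0 =
     \<lparr> pverts = {Pole False, Pole True},
       parcs = {(Pole False, Pole True), (Pole True, Pole False)} \<rparr>"
| "diamond (Suc n) =
     \<lparr> pverts = pverts (diamond n) \<union> {New (Upair u v) s | u v s. (u, v) \<in> parcs (diamond n)},
       parcs = {(u, New (Upair u v) s) | u v s. (u, v) \<in> parcs (diamond n)}
             \<union> {(New (Upair u v) s, u) | u v s. (u, v) \<in> parcs (diamond n)} \<rparr>"

lemma diamond_arcs_sym: "(u, v) \<in> parcs (diamond n) \<Longrightarrow> (v, u) \<in> parcs (diamond n)"
  by (cases n) auto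

lemma diamond_arcs_verts:
  "(u, v) \<in> parcs (diamond n) \<Longrightarrow> u \<in> pverts (diamond n) \<and> v \<in> pverts (diamond n)"
  by (induction n arbitrary: u v) (auto, blast+)

lemma diamond_finite: "finite (pverts (diamond n)) \<and> finite (parcs (diamond n))"
proof (induction n)
  case (Suc n)
  have fin: "finite {f u v s | u v s. (u, v) \<in> parcs (diamond n)}"
    for f :: "dvertex \<Rightarrow> dvertex \<Rightarrow> bool \<Rightarrow> 'c"
  proof (rule finite_subset)
    let ?g = "\<lambda>x. f (fst (fst x)) (snd (fst x)) (snd x)"
    show "{f u v s | u v s. (u, v) \<in> parcs (diamond n)} \<subseteq> ?g ` (parcs (diamond n) \<times> UNIV)"
    proof
      fix y assume "y \<in> {f u v s | u v s. (u, v) \<in> parcs (diamond n)}"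
      then obtain u v s where *: "y = f u v s" "(u, v) \<in> parcs (diamond n)"
        by blast
      show "y \<in> ?g ` (parcs (diamond n) \<times> UNIV)"
        by (rule image_eqI[where x = "((u, v), s)"]) (use * in simp_all)
    qed
    show "finite (?g ` (parcs (diamond n) \<times> UNIV))"
      using Suc by simp
  qed
  show ?case
    using Suc fin[of "\<lambda>u v s. New (Upair u v) s"] fin[of "\<lambda>u v s. (u, New (Upair u v) s)"]
      fin[of "\<lambda>u v s. (New (Upair u v) s, u)"]
    by (simp only: diamond.simps pair_pre_digraph.select_convs finite_Un simp_thms)
qed simp

lemma diamond_verts_mono: "m \<le> n \<Longrightarrow> pverts (diamond m) \<subseteq> pverts (diamond n)"
  by (induction n) (auto simp: le_Suc_eq)

lemma diamond_fresh_aux: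
  "(\<forall>u v s. (u, v) \<in> parcs (diamond n) \<longrightarrow> New (Upair u v) s \<notin> pverts (diamond n)) \<and>
   (\<forall>u v s. New (Upair u v) s \<in> pverts (diamond n) \<longrightarrow> u \<in> pverts (diamond n) \<and> v \<in> pverts (diamond n))"
proof (induction n)
  case (Suc n)
  have *: "u \<in> pverts (diamond n) \<and> v \<in> pverts (diamond n)"
    if mem: "New (Upair u v) s \<in> pverts (diamond (Suc n))" for u v s
  proof -
    consider "New (Upair u v) s \<in> pverts (diamond n)"
      | a b t where "New (Upair u v) s = New (Upair a b) t" "(a, b) \<in> parcs (diamond n)"
      using mem unfolding diamond.simps pair_pre_digraph.select_convs by blast
    then show ?thesis
    proof cases
      case 1
      then show ?thesis using Suc by blast
    next
      case 2
      then have "u = a \<and> v = b \<or> u = b \<and> v = a" by auto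
      then show ?thesis using 2(2) diamond_arcs_verts by blast
    qed
  qed
  have "u \<notin> pverts (diamond n) \<or> v \<notin> pverts (diamond n)"
    if arc: "(u, v) \<in> parcs (diamond (Suc n))" for u v
  proof -
    obtain a b t where "(a, b) \<in> parcs (diamond n)" "u = New (Upair a b) t \<or> v = New (Upair a b) t"
      using arc unfolding diamond.simps pair_pre_digraph.select_convs by blast
    then show ?thesis using Suc by blast
  qed
  moreover have "pverts (diamond n) \<subseteq> pverts (diamond (Suc n))"
    by (rule diamond_verts_mono) simp
  ultimately show ?case using * by blast
qed auto

lemma diamond_fresh: "(u, v) \<in> parcs (diamond n) \<Longrightarrow> New (Upair u v) s \<notin> pverts (diamond n)"
  using diamond_fresh_aux by blast

lemma diamond_arcs_neq: "(u, v) \<in> parcs (diamond n) \<Longrightarrow> u \<noteq> v"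
proof (cases n)
  case (Suc m)
  then show "(u, v) \<in> parcs (diamond n) \<Longrightarrow> u \<noteq> v"
    using diamond_fresh[of _ _ m] diamond_arcs_verts[of _ _ m] by auto metis+
qed auto


section \<open>Weighted diamonds\<close>

text \<open>An arc carries the index of the diamond graph it stems from, which determines its weight.\<close>

definition weighted_diamond_graph :: "nat \<Rightarrow> (dvertex, nat \<times> dvertex \<times> dvertex) pre_digraph" where
  "weighted_diamond_graph n =
     \<lparr> verts = pverts (diamond n),
       arcs = (SIGMA i:{..n}. parcs (diamond i)),
       tail = (\<lambda>(i, u, v). u),
       head = (\<lambda>(i, u, v). v) \<rparr>"

definition weighted_diamond_weight :: "real \<Rightarrow> nat \<times> dvertex \<times> dvertex \<Rightarrow> real" where
  "weighted_diamond_weight \<epsilon> = (\<lambda>(i, u, v). (1/2 + \<epsilon>) ^ i)"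

text \<open>\<open>wf_digraph.\<mu>\<close> is the infimum of the costs of all walks between two vertices.\<close>

definition weighted_diamond :: "real \<Rightarrow> nat \<Rightarrow> dvertex metric" where
  "weighted_diamond \<epsilon> n =
     metric (pverts (diamond n),
       \<lambda>u v. real_of_ereal
         (wf_digraph.\<mu> (weighted_diamond_graph n) (weighted_diamond_weight \<epsilon>) u v))"

lemma fin_digraph_weighted_diamond_graph: "fin_digraph (weighted_diamond_graph n)"
proof
  fix e assume "e \<in> arcs (weighted_diamond_graph n)"
  then obtain i u v where e: "e = (i, u, v)" "i \<le> n" "(u, v) \<in> parcs (diamond i)"
    by (auto simp: weighted_diamond_graph_def)
  then have "u \<in> pverts (diamond n)" "v \<in> pverts (diamond n)"
    using diamond_arcs_verts[of u v i] diamond_verts_mono[of i n] by auto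
  then show "tail (weighted_diamond_graph n) e \<in> verts (weighted_diamond_graph n)"
    "head (weighted_diamond_graph n) e \<in> verts (weighted_diamond_graph n)"
    using e by (auto simp: weighted_diamond_graph_def)
qed (auto simp: weighted_diamond_graph_def diamond_finite)

lemma weighted_diamond_reachable:
  assumes "u \<in> pverts (diamond n)" "v \<in> pverts (diamond n)"
  shows "u \<rightarrow>\<^sup>*\<^bsub>weighted_diamond_graph n\<^esub> v"
proof -
  let ?G = "weighted_diamond_graph n"
  interpret fin_digraph ?G by (rule fin_digraph_weighted_diamond_graph)
  have arc: "a \<rightarrow>\<^sup>*\<^bsub>?G\<^esub> b" if "i \<le> n" "(a, b) \<in> parcs (diamond i)" for i a b
  proof (rule reachable_adjI)
    have "(i, a, b) \<in> arcs ?G" using that by (auto simp: weighted_diamond_graph_def)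
    then have "arc_to_ends ?G (i, a, b) \<in> arcs_ends ?G" by (auto simp: arcs_ends_def)
    then show "a \<rightarrow>\<^bsub>?G\<^esub> b" by (auto simp: arc_to_ends_def weighted_diamond_graph_def)
  qed
  have "\<forall>w \<in> pverts (diamond m). Pole False \<rightarrow>\<^sup>*\<^bsub>?G\<^esub> w \<and> w \<rightarrow>\<^sup>*\<^bsub>?G\<^esub> Pole False" if "m \<le> n" for m
    using that
  proof (induction m)
    case 0
    have "Pole False \<in> verts ?G"
      using diamond_verts_mono[of 0 n] by (auto simp: weighted_diamond_graph_def)
    then show ?case using arc[of 0] by auto
  next
    case (Suc m)
    show ?case
    proof
      fix w assume "w \<in> pverts (diamond (Suc m))"
      then consider "w \<in> pverts (diamond m)"
        | a b s where "w = New (Upair a b) s" "(a, b) \<in> parcs (diamond m)" by auto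
      then show "Pole False \<rightarrow>\<^sup>*\<^bsub>?G\<^esub> w \<and> w \<rightarrow>\<^sup>*\<^bsub>?G\<^esub> Pole False"
      proof cases
        case 1 then show ?thesis using Suc by auto
      next
        case 2
        then have "a \<rightarrow>\<^sup>*\<^bsub>?G\<^esub> w" "w \<rightarrow>\<^sup>*\<^bsub>?G\<^esub> a"
          using arc[of "Suc m"] Suc.prems by (auto, blast+)
        moreover have "Pole False \<rightarrow>\<^sup>*\<^bsub>?G\<^esub> a" "a \<rightarrow>\<^sup>*\<^bsub>?G\<^esub> Pole False"
          using Suc 2 diamond_arcs_verts[of a b m] by auto
        ultimately show ?thesis using reachable_trans by blast
      qed
    qed
  qed
  then show ?thesis using assms reachable_trans by blast
qed

lemma Metric_space_weighted_diamond:
  assumes "0 < \<epsilon>"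
  shows "Metric_space (pverts (diamond n))
    (\<lambda>u v. real_of_ereal
       (wf_digraph.\<mu> (weighted_diamond_graph n) (weighted_diamond_weight \<epsilon>) u v))"
proof -
  let ?G = "weighted_diamond_graph n" and ?w = "weighted_diamond_weight \<epsilon>"
  interpret fin_digraph ?G by (rule fin_digraph_weighted_diamond_graph)
  have verts: "verts ?G = pverts (diamond n)" by (simp add: weighted_diamond_graph_def)
  have wpos: "?w e > 0" for e
    using assms by (auto simp: weighted_diamond_weight_def split: prod.splits intro!: zero_less_power)
  have wnn: "?w e \<ge> 0" for e using wpos[of e] by simp
  have nn: "\<mu> ?w u v \<ge> 0" for u v
    unfolding \<mu>_def by (rule INF_greatest) (auto intro: pos_cost_pos_awalk_cost wnn)
  have rev: "\<exists>q. awalk v q u \<and> awalk_cost ?w q = awalk_cost ?w p" if "awalk u p v" for u p v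
    using that
  proof (induction p arbitrary: u)
    case Nil then show ?case by (intro exI[of _ "[]"]) (auto simp: awalk_Nil_iff)
  next
    case (Cons e p)
    obtain i a b where e: "e = (i, a, b)" by (cases e)
    from Cons.prems have *: "e \<in> arcs ?G" "u = tail ?G e" "awalk (head ?G e) p v"
      by (auto simp: awalk_Cons_iff)
    with Cons.IH obtain q where q: "awalk v q (head ?G e)" "awalk_cost ?w q = awalk_cost ?w p" by blast
    let ?e = "(i, b, a)"
    have "?e \<in> arcs ?G" "tail ?G ?e = head ?G e" "head ?G ?e = u"
      using * e diamond_arcs_sym by (auto simp: weighted_diamond_graph_def)
    then have "awalk (head ?G e) [?e] u"
      by (metis arc_implies_awalk)
    with q have "awalk v (q @ [?e]) u" by (auto intro: awalk_appendI)
    moreover have "awalk_cost ?w (q @ [?e]) = awalk_cost ?w (e # p)"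
      using q e by (simp add: weighted_diamond_weight_def)
    ultimately show ?case by blast
  qed
  have le: "\<mu> ?w v u \<le> \<mu> ?w u v" for u v
    unfolding \<mu>_def[of _ u v]
    by (rule INF_greatest) (metis min_cost_le_walk_cost rev mem_Collect_eq)
  have att: "\<exists>p. awalk u p v \<and> \<mu> ?w u v = awalk_cost ?w p"
    if "u \<in> pverts (diamond n)" "v \<in> pverts (diamond n)" for u v
    using min_cost_awalk[OF weighted_diamond_reachable[OF that], of ?w] wnn
    by (auto simp: apath_def)
  show ?thesis
  proof
    fix x y z
    show "0 \<le> real_of_ereal (\<mu> ?w x y)" using nn by (simp add: real_of_ereal_pos)
    show "real_of_ereal (\<mu> ?w x y) = real_of_ereal (\<mu> ?w y x)"
      using le[of x y] le[of y x] by simp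
    assume x: "x \<in> pverts (diamond n)" and y: "y \<in> pverts (diamond n)"
    obtain p where p: "awalk x p y" "\<mu> ?w x y = awalk_cost ?w p" using att[OF x y] by blast
    show "real_of_ereal (\<mu> ?w x y) = 0 \<longleftrightarrow> x = y"
    proof
      assume "x = y"
      then have "awalk x [] y" using x verts by (auto simp: awalk_Nil_iff)
      then have "\<mu> ?w x y \<le> 0" using min_cost_le_walk_cost[of x "[]" y ?w] by (simp add: zero_ereal_def)
      then show "real_of_ereal (\<mu> ?w x y) = 0" using nn[of x y] by simp
    next
      assume 0: "real_of_ereal (\<mu> ?w x y) = 0"
      show "x = y"
      proof (cases p)
        case Nil then show ?thesis using p by (auto simp: awalk_Nil_iff)
      next
        case (Cons e q)
        have "awalk (head ?G e) q y" using p Cons by (auto simp: awalk_Cons_iff)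
        then have "awalk_cost ?w q \<ge> 0" using pos_cost_pos_awalk_cost wnn by blast
        then show ?thesis using 0 p Cons wpos[of e] by simp
      qed
    qed
    assume z: "z \<in> pverts (diamond n)"
    obtain q where q: "awalk y q z" "\<mu> ?w y z = awalk_cost ?w q" using att[OF y z] by blast
    obtain r where r: "awalk x r z" "\<mu> ?w x z = awalk_cost ?w r" using att[OF x z] by blast
    have "awalk x (p @ q) z" using p q by (auto intro: awalk_appendI)
    from min_cost_le_walk_cost[OF this, of ?w]
    show "real_of_ereal (\<mu> ?w x z) \<le> real_of_ereal (\<mu> ?w x y) + real_of_ereal (\<mu> ?w y z)"
      using p q r by simp
  qed
qed

lemma weighted_diamond_simps:
  assumes "0 < \<epsilon>"
  shows "mspace (weighted_diamond \<epsilon> n) = pverts (diamond n)"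
    and "mdist (weighted_diamond \<epsilon> n) u v = real_of_ereal
       (wf_digraph.\<mu> (weighted_diamond_graph n) (weighted_diamond_weight \<epsilon>) u v)"
  unfolding weighted_diamond_def
  by (simp_all add: Metric_space.mspace_metric[OF Metric_space_weighted_diamond[OF assms]]
      Metric_space.mdist_metric[OF Metric_space_weighted_diamond[OF assms]])


section \<open>Euclidean spaces\<close>

text \<open>
  The dimension varies inside the theorem, so it has to be a term: the points of the
  \<open>k\<close>-dimensional space are the real sequences that vanish from index \<open>k\<close> on, which is also
  the carrier of the library topology \<^const>\<open>Euclidean_space\<close>.
\<close>

definition euclidean_metric :: "nat \<Rightarrow> (nat \<Rightarrow> real) metric" where
  "euclidean_metric k =
     metric (topspace (Euclidean_space k), \<lambda>x y. L2_set (\<lambda>i. x i - y i) {..<k})"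

lemma Metric_space_euclidean:
  "Metric_space (topspace (Euclidean_space k)) (\<lambda>x y. L2_set (\<lambda>i. x i - y i) {..<k})"
proof
  fix x y z :: "nat \<Rightarrow> real"
  show "0 \<le> L2_set (\<lambda>i. x i - y i) {..<k}" by simp
  show "L2_set (\<lambda>i. x i - y i) {..<k} = L2_set (\<lambda>i. y i - x i) {..<k}"
    by (simp add: L2_set_def power2_commute)
  show "L2_set (\<lambda>i. x i - z i) {..<k} \<le> L2_set (\<lambda>i. x i - y i) {..<k} + L2_set (\<lambda>i. y i - z i) {..<k}"
    using L2_set_triangle_ineq[of "\<lambda>i. x i - y i" "\<lambda>i. y i - z i" "{..<k}"] by simp
  assume "x \<in> topspace (Euclidean_space k)" "y \<in> topspace (Euclidean_space k)"
  then show "L2_set (\<lambda>i. x i - y i) {..<k} = 0 \<longleftrightarrow> x = y"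
    by (auto simp: L2_set_eq_0_iff topspace_Euclidean_space fun_eq_iff) (metis lessThan_iff not_less)
qed

lemma euclidean_metric_simps:
  "mspace (euclidean_metric k) = topspace (Euclidean_space k)"
  "mdist (euclidean_metric k) x y = L2_set (\<lambda>i. x i - y i) {..<k}"
  unfolding euclidean_metric_def
  by (simp_all add: Metric_space.mspace_metric[OF Metric_space_euclidean]
      Metric_space.mdist_metric[OF Metric_space_euclidean])


section \<open>Isometries and distortion\<close>

definition isometric :: "'a metric \<Rightarrow> 'b metric \<Rightarrow> bool" where
  "isometric X Y \<longleftrightarrow>
     (\<exists>f. bij_betw f (mspace X) (mspace Y) \<and>
          (\<forall>x \<in> mspace X. \<forall>y \<in> mspace X. mdist Y (f x) (f y) = mdist X x y))"

text \<open>
  The suprema are taken in the extended nonnegative reals, so they exist even if the ratios are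
  unbounded, and a map on a one-point space has distortion 0.
\<close>

definition distortion :: "'a metric \<Rightarrow> 'b metric \<Rightarrow> ('a \<Rightarrow> 'b) \<Rightarrow> ennreal" where
  "distortion X Y f =
     (SUP (x, y) \<in> {(x, y). x \<in> mspace X \<and> y \<in> mspace X \<and> x \<noteq> y}.
        ennreal (mdist Y (f x) (f y) / mdist X x y)) *
     (SUP (x, y) \<in> {(x, y). x \<in> mspace X \<and> y \<in> mspace X \<and> x \<noteq> y}.
        ennreal (mdist X x y / mdist Y (f x) (f y)))"

definition embeds_with_distortion :: "'a metric \<Rightarrow> 'b metric \<Rightarrow> real \<Rightarrow> bool" where
  "embeds_with_distortion X Y K \<longleftrightarrow>
     (\<exists>f. f ` mspace X \<subseteq> mspace Y \<and> inj_on f (mspace X) \<and> distortion X Y f \<le> ennreal K)"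


section \<open>Classes of finite metric spaces\<close>

text \<open>
  A class of finite metric spaces is a set of spaces whose points come from a type \<^typ>\<open>'a\<close>.
  All statements are polymorphic in \<^typ>\<open>'a\<close>; for \<^typ>\<open>nat\<close>, or any other infinite type, every
  finite metric space is isometric to one with points in \<^typ>\<open>'a\<close>.
\<close>

definition finite_metric_space :: "'a metric \<Rightarrow> bool" where
  "finite_metric_space X \<longleftrightarrow> finite (mspace X) \<and> mspace X \<noteq> {}"

definition equilateral :: "'a metric \<Rightarrow> bool" where
  "equilateral X \<longleftrightarrow>
     (\<exists>r > 0. \<forall>x \<in> mspace X. \<forall>y \<in> mspace X. x \<noteq> y \<longrightarrow> mdist X x y = r)"

definition equilateral_class :: "'a metric set" where
  "equilateral_class = {X. finite_metric_space X \<and> equilateral X}"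

definition euclidean_class :: "nat \<Rightarrow> real \<Rightarrow> 'a metric set" where
  "euclidean_class k C =
     {X. finite_metric_space X \<and> embeds_with_distortion X (euclidean_metric k) C}"


section \<open>Metric composition\<close>

definition metric_diam :: "'a metric \<Rightarrow> real" where
  "metric_diam X = Max {mdist X x y | x y. x \<in> mspace X \<and> y \<in> mspace X}"

definition composition_gamma :: "'a metric \<Rightarrow> ('a \<Rightarrow> 'b metric) \<Rightarrow> real" where
  "composition_gamma M N =
     Max ((\<lambda>z. metric_diam (N z)) ` mspace M) /
     Min {mdist M x y | x y. x \<in> mspace M \<and> y \<in> mspace M \<and> x \<noteq> y}"

text \<open>
  \<open>V\<close> is the composition of \<open>M\<close> with the spaces \<open>N x\<close>.  This is a relation since the library
  does not prescribe the distance of a metric outside its carrier.  If \<open>M\<close> has only one point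
  \<open>x\<close>, the conditions involving \<open>composition_gamma M N\<close> are vacuous, and \<open>V\<close> is \<open>N x\<close>.
\<close>

definition is_composition :: "real \<Rightarrow> 'a metric \<Rightarrow> ('a \<Rightarrow> 'b metric) \<Rightarrow> 'b metric \<Rightarrow> bool" where
  "is_composition \<beta> M N V \<longleftrightarrow>
     \<beta> \<ge> 1/2 \<and>
     finite_metric_space M \<and>
     (\<forall>x \<in> mspace M. finite_metric_space (N x)) \<and>
     disjoint_family_on (\<lambda>x. mspace (N x)) (mspace M) \<and>
     mspace V = (\<Union>x \<in> mspace M. mspace (N x)) \<and>
     (\<forall>x \<in> mspace M. \<forall>u \<in> mspace (N x). \<forall>v \<in> mspace (N x). mdist V u v = mdist (N x) u v) \<and>
     (\<forall>x \<in> mspace M. \<forall>y \<in> mspace M. x \<noteq> y \<longrightarrow>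
        composition_gamma M N > 0 \<and>
        (\<forall>u \<in> mspace (N x). \<forall>v \<in> mspace (N y).
           mdist V u v = \<beta> * composition_gamma M N * mdist M x y))"

inductive_set comp_class :: "real \<Rightarrow> 'a metric set \<Rightarrow> 'a metric set"
  for \<beta> :: real and \<M> :: "'a metric set" where
  base: "V \<in> \<M> \<Longrightarrow> V \<in> comp_class \<beta> \<M>"
| compose: "M \<in> \<M> \<Longrightarrow> \<beta>' \<ge> \<beta> \<Longrightarrow>
    (\<And>x. x \<in> mspace M \<Longrightarrow> S x \<in> comp_class \<beta> \<M> \<and> isometric (N x) (S x)) \<Longrightarrow>
    is_composition \<beta>' M N V \<Longrightarrow> V \<in> comp_class \<beta> \<M>"

end

theory Submission
  imports Defs "HOL-Real_Asymp.Real_Asymp"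
begin

text \<open>
  Put $w = \frac12 + \varepsilon$, so that $\frac12 < w < 1$.  The diamond $W_n$ is connected by
  steps of length at most $w^n$, whereas distinct vertices of $D_i$ have distance at least $w^i$
  in $W_n$.  These two facts make a metric composition useless for embedding $W_n$.

  Consider a map $f$ with distortion at most $K$ from $W_n$ into a composition
  $M_{\beta'}[\mathcal N]$, after rescaling such that $f$ does not decrease distances and
  stretches them at most by $K$.  If the image lies in one of the clusters $N_x$, then the
  composition may be replaced by $N_x$, which was constructed earlier.  Otherwise some step of
  length at most $w^n$ changes the cluster, so that some gap between two clusters is at most
  $K w^n$.  Since $\beta' \ge 1$, no cluster has a diameter larger than a gap
  (\<open>composition_cluster_le_gap\<close>).  Take a constant $c$ with $K w^c < 1$ and $i = n - c$: the
  vertices of $D_i$ are more than $K w^n$ apart, hence lie in distinct clusters, and the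
  distances between clusters are proportional to those of $M$.  So $f$ induces a map of distortion
  at most $K$ from the vertices of $D_i$ into the single factor $M$
  (\<open>bilipschitz_on_composition\<close>).  By induction, a map into any space of the composition
  class yields such a map into a factor.

  A factor cannot receive $D_i$.  If $M$ is equilateral, the two poles, at distance
  at least $1$, and a pole with one of its neighbours in $D_i$, at distance at most $w^i$, have
  equally distant images, although $K w^i < 1$ for large $n$.  If $M$ lies with distortion $C$ in
  Euclidean space of dimension $k$, then the $2^i$ neighbours of a pole in $D_i$ have pairwise
  distances at least $w^i$ and lie within $w^i$ of the pole; a grid count bounds the number of
  such points by $(2kCK + 2)^k$.  This is smaller than $2^{n-c}$ for large $n$ if
  $k = d_n = O((\log n)^2)$, because $d_n \log d_n = o(n)$.
\<close>


section \<open>Maps that distort all distances by comparable factors\<close>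

text \<open>
  The scale \<open>a\<close> is part of the map and not of the relation, because distortion does not change
  when the target is rescaled.
\<close>

definition bilipschitz_on :: "real \<Rightarrow> 'a set \<Rightarrow> 'a metric \<Rightarrow> 'b metric \<Rightarrow> ('a \<Rightarrow> 'b) \<Rightarrow> bool" where
  "bilipschitz_on K A X Y f \<longleftrightarrow>
     f ` A \<subseteq> mspace Y \<and>
     (\<exists>a > 0. \<forall>x \<in> A. \<forall>y \<in> A.
        a * mdist X x y \<le> mdist Y (f x) (f y) \<and> mdist Y (f x) (f y) \<le> K * a * mdist X x y)"

lemma mdist_gt_0: "x \<in> mspace X \<Longrightarrow> y \<in> mspace X \<Longrightarrow> x \<noteq> y \<Longrightarrow> mdist X x y > 0"
  using mdist_nonneg[of X x y] mdist_zero[of x X y] by linarith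

lemma bilipschitz_on_subset:
  "bilipschitz_on K A X Y f \<Longrightarrow> B \<subseteq> A \<Longrightarrow> bilipschitz_on K B X Y f"
  unfolding bilipschitz_on_def by (meson image_mono order_trans subset_iff)

lemma bilipschitz_on_compose:
  assumes "bilipschitz_on K A X Y f" "bilipschitz_on L (mspace Y) Y Z g" "L \<ge> 0"
  shows "bilipschitz_on (L * K) A X Z (g \<circ> f)"
proof -
  obtain a where a: "f ` A \<subseteq> mspace Y" "a > 0"
    "\<And>x y. x \<in> A \<Longrightarrow> y \<in> A \<Longrightarrow> a * mdist X x y \<le> mdist Y (f x) (f y)"
    "\<And>x y. x \<in> A \<Longrightarrow> y \<in> A \<Longrightarrow> mdist Y (f x) (f y) \<le> K * a * mdist X x y"
    using assms(1) unfolding bilipschitz_on_def by blast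
  obtain b where b: "g ` mspace Y \<subseteq> mspace Z" "b > 0"
    "\<And>x y. x \<in> mspace Y \<Longrightarrow> y \<in> mspace Y \<Longrightarrow> b * mdist Y x y \<le> mdist Z (g x) (g y)"
    "\<And>x y. x \<in> mspace Y \<Longrightarrow> y \<in> mspace Y \<Longrightarrow> mdist Z (g x) (g y) \<le> L * b * mdist Y x y"
    using assms(2) unfolding bilipschitz_on_def by blast
  have "b * a * mdist X x y \<le> mdist Z (g (f x)) (g (f y)) \<and>
      mdist Z (g (f x)) (g (f y)) \<le> L * K * (b * a) * mdist X x y"
    if xy: "x \<in> A" "y \<in> A" for x y
  proof
    have "b * (a * mdist X x y) \<le> b * mdist Y (f x) (f y)"
      using a(3)[OF xy] b(2) by (intro mult_left_mono) auto
    also have "\<dots> \<le> mdist Z (g (f x)) (g (f y))" using a(1) b(3) xy by blast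
    finally show "b * a * mdist X x y \<le> mdist Z (g (f x)) (g (f y))" by (simp add: mult.assoc)
    have "mdist Z (g (f x)) (g (f y)) \<le> L * b * mdist Y (f x) (f y)"
      using a(1) b(4) xy by blast
    also have "\<dots> \<le> L * b * (K * a * mdist X x y)"
      using a(4)[OF xy] b(2) assms(3) by (intro mult_left_mono) auto
    finally show "mdist Z (g (f x)) (g (f y)) \<le> L * K * (b * a) * mdist X x y"
      by (simp add: mult_ac)
  qed
  moreover have "(g \<circ> f) ` A \<subseteq> mspace Z" "b * a > 0" using a(1,2) b(1,2) by auto
  ultimately show ?thesis unfolding bilipschitz_on_def comp_def by blast
qed

lemma isometric_imp_bilipschitz_on:
  assumes "isometric X Y"
  obtains f where "bilipschitz_on 1 (mspace X) X Y f"
proof -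
  obtain f where "f ` mspace X = mspace Y"
    "\<forall>x\<in>mspace X. \<forall>y\<in>mspace X. mdist Y (f x) (f y) = mdist X x y"
    using assms unfolding isometric_def by (auto simp: bij_betw_def)
  then have "bilipschitz_on 1 (mspace X) X Y f"
    unfolding bilipschitz_on_def by (intro conjI exI[of _ 1]) auto
  then show ?thesis using that by blast
qed

text \<open>
  If \<open>A\<close> is the supremum of the expansions and \<open>B\<close> that of the contractions, then \<open>1 / B\<close> is a
  scale as required.  Both are finite since each of them is positive as soon as there are two
  points, and their product is finite.
\<close>

lemma embeds_with_distortion_imp_bilipschitz_on:
  assumes emb: "embeds_with_distortion X Y K" and "K \<ge> 0"
  obtains f where "bilipschitz_on K (mspace X) X Y f"
proof -
  obtain f where f: "f ` mspace X \<subseteq> mspace Y" "inj_on f (mspace X)" "distortion X Y f \<le> ennreal K"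
    using emb unfolding embeds_with_distortion_def by blast
  define P where "P = {(x, y). x \<in> mspace X \<and> y \<in> mspace X \<and> x \<noteq> y}"
  define A where "A = (SUP (x, y) \<in> P. ennreal (mdist Y (f x) (f y) / mdist X x y))"
  define B where "B = (SUP (x, y) \<in> P. ennreal (mdist X x y / mdist Y (f x) (f y)))"
  have AB: "A * B \<le> ennreal K" using f(3) unfolding distortion_def A_def B_def P_def .
  have pos: "mdist X x y > 0 \<and> mdist Y (f x) (f y) > 0" if "(x, y) \<in> P" for x y
  proof -
    have "x \<in> mspace X" "y \<in> mspace X" "x \<noteq> y" using that by (auto simp: P_def)
    moreover from this have "f x \<noteq> f y" using f(2) by (auto simp: inj_on_def)
    moreover have "f x \<in> mspace Y" "f y \<in> mspace Y" using f(1) calculation by auto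
    ultimately show ?thesis by (simp add: mdist_gt_0)
  qed
  have upA: "ennreal (mdist Y (f x) (f y) / mdist X x y) \<le> A" if "(x, y) \<in> P" for x y
    unfolding A_def using that by (intro SUP_upper2[of "(x, y)"]) auto
  have upB: "ennreal (mdist X x y / mdist Y (f x) (f y)) \<le> B" if "(x, y) \<in> P" for x y
    unfolding B_def using that by (intro SUP_upper2[of "(x, y)"]) auto
  have self: "mdist X x x = 0" "mdist Y (f x) (f x) = 0" if "x \<in> mspace X" for x
    using that f(1) by (auto simp: mdist_zero)
  show ?thesis
  proof (cases "P = {}")
    case True
    have "1 * mdist X x y \<le> mdist Y (f x) (f y) \<and> mdist Y (f x) (f y) \<le> K * 1 * mdist X x y"
      if xy: "x \<in> mspace X" "y \<in> mspace X" for x y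
    proof -
      have "y = x" using True xy by (auto simp: P_def)
      then show ?thesis using self[OF xy(1)] by simp
    qed
    then have "bilipschitz_on K (mspace X) X Y f"
      unfolding bilipschitz_on_def using f(1) zero_less_one by blast
    then show ?thesis by (rule that)
  next
    case False
    then obtain x0 y0 where p0: "(x0, y0) \<in> P" by (auto simp: P_def)
    have "A > 0" "B > 0"
      using less_le_trans[OF _ upA[OF p0], of 0] less_le_trans[OF _ upB[OF p0], of 0] pos[OF p0]
      by simp_all
    then have "A \<noteq> top" "B \<noteq> top"
      using AB by (auto simp: ennreal_top_mult ennreal_mult_top top_unique split: if_splits)
    then obtain r s where rs: "A = ennreal r" "B = ennreal s" "r \<ge> 0" "s \<ge> 0"
      by (metis ennreal_cases)
    have s: "s > 0" using \<open>B > 0\<close> rs by simp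
    have "ennreal (r * s) \<le> ennreal K" using AB rs by (simp add: ennreal_mult)
    then have rsK: "r * s \<le> K" using assms(2) by (simp add: ennreal_le_iff)
    have "1 / s * mdist X x y \<le> mdist Y (f x) (f y) \<and> mdist Y (f x) (f y) \<le> K * (1 / s) * mdist X x y"
      if xy: "x \<in> mspace X" "y \<in> mspace X" for x y
    proof (cases "x = y")
      case True then show ?thesis using self[OF xy(1)] by simp
    next
      case False
      then have p: "(x, y) \<in> P" using xy by (auto simp: P_def)
      have "mdist X x y / mdist Y (f x) (f y) \<le> s" using upB[OF p] rs by (simp add: ennreal_le_iff)
      then have 1: "1 / s * mdist X x y \<le> mdist Y (f x) (f y)"
        using pos[OF p] s by (simp add: field_simps)
      have "mdist Y (f x) (f y) / mdist X x y \<le> r" using upA[OF p] rs by (simp add: ennreal_le_iff)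
      then have "mdist Y (f x) (f y) \<le> r * mdist X x y" using pos[OF p] by (simp add: field_simps)
      also have "\<dots> \<le> K * (1 / s) * mdist X x y"
        using rsK s pos[OF p] by (intro mult_right_mono) (auto simp: field_simps)
      finally show ?thesis using 1 by blast
    qed
    moreover have "1 / s > 0" using s by simp
    ultimately have "bilipschitz_on K (mspace X) X Y f"
      unfolding bilipschitz_on_def using f(1) by blast
    then show ?thesis by (rule that)
  qed
qed


section \<open>Maps of chain connected sets into a metric composition\<close>

lemma metric_diam_ge:
  assumes "finite_metric_space X" "u \<in> mspace X" "v \<in> mspace X"
  shows "mdist X u v \<le> metric_diam X"
  unfolding metric_diam_def
proof (rule Max_ge)
  show "finite {mdist X x y |x y. x \<in> mspace X \<and> y \<in> mspace X}"
    using assms(1) by (auto simp: finite_metric_space_def intro: finite_image_set2)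
qed (use assms in blast)

lemma is_compositionD:
  assumes "is_composition \<beta> M N V"
  shows "finite (mspace M)"
    and "x \<in> mspace M \<Longrightarrow> finite_metric_space (N x)"
    and "mspace V = (\<Union>x \<in> mspace M. mspace (N x))"
    and "x \<in> mspace M \<Longrightarrow> u \<in> mspace (N x) \<Longrightarrow> v \<in> mspace (N x) \<Longrightarrow> mdist V u v = mdist (N x) u v"
    and "x \<in> mspace M \<Longrightarrow> y \<in> mspace M \<Longrightarrow> x \<noteq> y \<Longrightarrow> composition_gamma M N > 0"
    and "x \<in> mspace M \<Longrightarrow> y \<in> mspace M \<Longrightarrow> x \<noteq> y \<Longrightarrow> u \<in> mspace (N x) \<Longrightarrow> v \<in> mspace (N y) \<Longrightarrow>
      mdist V u v = \<beta> * composition_gamma M N * mdist M x y"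
  using assms by (simp_all add: is_composition_def finite_metric_space_def)

text \<open>
  The factor \<open>composition_gamma\<close> is normalised such that the smallest gap between two clusters
  is \<open>\<beta>\<close> times the largest cluster diameter.
\<close>

lemma composition_cluster_le_gap:
  assumes comp: "is_composition \<beta> M N V" and "\<beta> \<ge> 1"
    and xy: "x \<in> mspace M" "y \<in> mspace M" "x \<noteq> y"
    and z: "z \<in> mspace M" "u \<in> mspace (N z)" "v \<in> mspace (N z)"
  shows "mdist V u v \<le> \<beta> * composition_gamma M N * mdist M x y"
proof -
  let ?G = "composition_gamma M N"
  let ?D = "Max ((\<lambda>z. metric_diam (N z)) ` mspace M)"
  let ?S = "{mdist M x y | x y. x \<in> mspace M \<and> y \<in> mspace M \<and> x \<noteq> y}"
  have finM: "finite (mspace M)" and finN: "finite_metric_space (N z)" and G: "?G > 0"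
    and V: "mdist V u v = mdist (N z) u v"
    using is_compositionD(1,2,4,5)[OF comp] xy z by blast+
  have "?S \<subseteq> {mdist M x y | x y. x \<in> mspace M \<and> y \<in> mspace M}" by blast
  moreover have "finite \<dots>" using finM by (auto intro: finite_image_set2)
  ultimately have finS: "finite ?S" by (rule finite_subset)
  have memS: "mdist M x y \<in> ?S" using xy by blast
  have "Min ?S \<in> ?S" using finS memS by (intro Min_in) auto
  then have m: "Min ?S > 0" using mdist_gt_0 by fastforce
  have "mdist V u v \<le> metric_diam (N z)" using metric_diam_ge[OF finN z(2,3)] V by simp
  also have "\<dots> \<le> ?D" using finM z(1) by (intro Max_ge) auto
  also have "\<dots> = ?G * Min ?S" using m unfolding composition_gamma_def by simp
  also have "\<dots> \<le> ?G * mdist M x y" using finS memS G by (intro mult_left_mono Min_le) auto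
  also have "\<dots> \<le> \<beta> * (?G * mdist M x y)" using assms(2) G mult_right_mono[of 1 \<beta> "?G * mdist M x y"] by simp
  finally show ?thesis by (simp add: mult.assoc)
qed

text \<open>
  If the chain connected set \<open>A\<close> is not mapped into one cluster, a step of some chain crosses a
  gap.  This gap, hence every cluster diameter, is small, and the points of the well separated
  set \<open>B\<close> have to use a cluster each; the distances between clusters are multiples of those of
  \<open>M\<close>, so the map that sends a point to its cluster is as good on \<open>B\<close> as the given one.
\<close>

lemma bilipschitz_on_composition:
  assumes comp: "is_composition \<beta> M N V" and "\<beta> \<ge> 1"
    and f: "bilipschitz_on K A X V f" and "K \<ge> 0"
    and chain: "\<And>p q. p \<in> A \<Longrightarrow> q \<in> A \<Longrightarrow> (p, q) \<in> {(u, v). u \<in> A \<and> v \<in> A \<and> mdist X u v \<le> \<delta>}\<^sup>*"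
    and "A \<noteq> {}" "B \<subseteq> A"
    and sep: "\<And>p q. p \<in> B \<Longrightarrow> q \<in> B \<Longrightarrow> p \<noteq> q \<Longrightarrow> mdist X p q > K * \<delta>"
    and BX: "B \<subseteq> mspace X"
  shows "(\<exists>x \<in> mspace M. bilipschitz_on K A X (N x) f) \<or> (\<exists>g. bilipschitz_on K B X M g)"
proof -
  obtain a where a: "f ` A \<subseteq> mspace V" "a > 0"
    "\<And>x y. x \<in> A \<Longrightarrow> y \<in> A \<Longrightarrow> a * mdist X x y \<le> mdist V (f x) (f y)"
    "\<And>x y. x \<in> A \<Longrightarrow> y \<in> A \<Longrightarrow> mdist V (f x) (f y) \<le> K * a * mdist X x y"
    using f unfolding bilipschitz_on_def by blast
  have "\<forall>p \<in> A. \<exists>x. x \<in> mspace M \<and> f p \<in> mspace (N x)"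
    using a(1) is_compositionD(3)[OF comp] by blast
  then obtain c where c: "\<And>p. p \<in> A \<Longrightarrow> c p \<in> mspace M" "\<And>p. p \<in> A \<Longrightarrow> f p \<in> mspace (N (c p))"
    by metis
  show ?thesis
  proof (cases "\<exists>x. \<forall>p \<in> A. c p = x")
    case True
    then obtain x where x: "\<And>p. p \<in> A \<Longrightarrow> c p = x" by blast
    then have xM: "x \<in> mspace M" using c \<open>A \<noteq> {}\<close> by blast
    have img: "f ` A \<subseteq> mspace (N x)" using c x by blast
    have "mdist (N x) (f p) (f q) = mdist V (f p) (f q)" if "p \<in> A" "q \<in> A" for p q
      using is_compositionD(4)[OF comp xM] img that by (metis image_subset_iff)
    then have "\<forall>p \<in> A. \<forall>q \<in> A. a * mdist X p q \<le> mdist (N x) (f p) (f q) \<and>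
        mdist (N x) (f p) (f q) \<le> K * a * mdist X p q"
      using a(3,4) by simp
    then have "bilipschitz_on K A X (N x) f"
      unfolding bilipschitz_on_def using img a(2) by blast
    then show ?thesis using xM by blast
  next
    case False
    then obtain p q where pq: "p \<in> A" "q \<in> A" "c p \<noteq> c q" by (metis \<open>A \<noteq> {}\<close>)
    have "c p = c q \<or> (\<exists>u v. u \<in> A \<and> v \<in> A \<and> mdist X u v \<le> \<delta> \<and> c u \<noteq> c v)"
      using chain[OF pq(1,2)] by (induction rule: rtrancl_induct) force+
    with pq obtain u v where uv: "u \<in> A" "v \<in> A" "mdist X u v \<le> \<delta>" "c u \<noteq> c v" by blast
    let ?G = "composition_gamma M N"
    have G: "?G > 0" using is_compositionD(5)[OF comp] uv c(1) by blast
    have cross: "mdist V (f p) (f q) = \<beta> * ?G * mdist M (c p) (c q)"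
      if "p \<in> A" "q \<in> A" "c p \<noteq> c q" for p q
      using is_compositionD(6)[OF comp] c that by blast
    \<comment> \<open>The step from \<open>u\<close> to \<open>v\<close> bounds a gap, and thereby all cluster diameters.\<close>
    have gap: "\<beta> * ?G * mdist M (c u) (c v) \<le> a * (K * \<delta>)"
    proof -
      have "mdist V (f u) (f v) \<le> K * a * mdist X u v" using a(4) uv by blast
      also have "\<dots> \<le> K * a * \<delta>" using uv a(2) \<open>K \<ge> 0\<close> by (intro mult_left_mono) auto
      finally show ?thesis using cross[OF uv(1,2,4)] by (simp add: mult_ac)
    qed
    have inj: "c p \<noteq> c q" if pq: "p \<in> B" "q \<in> B" "p \<noteq> q" for p q
    proof
      assume eq: "c p = c q"
      have A: "p \<in> A" "q \<in> A" using pq \<open>B \<subseteq> A\<close> by auto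
      have "a * (K * \<delta>) < a * mdist X p q" using sep[OF pq] a(2) by simp
      also have "\<dots> \<le> mdist V (f p) (f q)" using a(3) A by blast
      also have "\<dots> \<le> \<beta> * ?G * mdist M (c u) (c v)"
        using composition_cluster_le_gap[OF comp \<open>\<beta> \<ge> 1\<close> c(1)[OF uv(1)] c(1)[OF uv(2)] uv(4)
            c(1)[OF A(1)] c(2)[OF A(1)]] c(2)[OF A(2)] eq by simp
      finally show False using gap by simp
    qed
    define t where "t = \<beta> * ?G"
    have t: "t > 0" using G \<open>\<beta> \<ge> 1\<close> by (simp add: t_def)
    have "a / t * mdist X p q \<le> mdist M (c p) (c q) \<and>
        mdist M (c p) (c q) \<le> K * (a / t) * mdist X p q"
      if pq: "p \<in> B" "q \<in> B" for p q
    proof (cases "p = q")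
      case True
      have "mdist X p p = 0" "mdist M (c p) (c p) = 0"
        using pq BX c(1) \<open>B \<subseteq> A\<close> by (auto simp: mdist_zero subset_iff)
      then show ?thesis using True by simp
    next
      case False
      have A: "p \<in> A" "q \<in> A" using pq \<open>B \<subseteq> A\<close> by auto
      have "mdist M (c p) (c q) = mdist V (f p) (f q) / t"
        using cross[OF A inj[OF pq False]] t by (simp add: t_def[symmetric])
      then show ?thesis using a(3,4)[OF A] t by (simp add: field_simps)
    qed
    moreover have "a / t > 0" using t a(2) by simp
    moreover have "c ` B \<subseteq> mspace M" using c \<open>B \<subseteq> A\<close> by blast
    ultimately have "bilipschitz_on K B X M c" unfolding bilipschitz_on_def by blast
    then show ?thesis by blast
  qed
qed


section \<open>Distances in weighted diamonds\<close>

lemma Pole_in_diamond: "Pole b \<in> pverts (diamond n)"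
proof -
  have "Pole b \<in> pverts (diamond 0)" by (cases b) auto
  then show ?thesis using diamond_verts_mono[of 0 n] by blast
qed

lemma weighted_diamond_dist_arc_le:
  assumes "0 < \<epsilon>" "i \<le> n" "(u, v) \<in> parcs (diamond i)"
  shows "mdist (weighted_diamond \<epsilon> n) u v \<le> (1/2 + \<epsilon>) ^ i"
proof -
  let ?G = "weighted_diamond_graph n" and ?w = "weighted_diamond_weight \<epsilon>"
  interpret fin_digraph ?G by (rule fin_digraph_weighted_diamond_graph)
  have uv: "u \<in> pverts (diamond n)" "v \<in> pverts (diamond n)"
    using diamond_arcs_verts[OF assms(3)] diamond_verts_mono[OF assms(2)] by auto
  have "(i, u, v) \<in> arcs ?G" using assms by (auto simp: weighted_diamond_graph_def)
  moreover have "tail ?G (i, u, v) = u" "head ?G (i, u, v) = v"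
    by (auto simp: weighted_diamond_graph_def)
  ultimately have "awalk u [(i, u, v)] v" by (metis arc_implies_awalk)
  from min_cost_le_walk_cost[OF this, of ?w]
  have le: "\<mu> ?w u v \<le> ereal ((1/2 + \<epsilon>) ^ i)" by (simp add: weighted_diamond_weight_def)
  then show ?thesis
    unfolding weighted_diamond_simps[OF assms(1)] using assms(1)
    by (cases "\<mu> ?w u v") (auto)
qed

text \<open>
  Lower bounds for shortest path distances come from potentials that change along each edge by
  at most its weight.
\<close>

lemma weighted_diamond_lipschitz:
  assumes "0 < \<epsilon>" "u \<in> pverts (diamond n)" "v \<in> pverts (diamond n)"
    and lip: "\<And>i x y. i \<le> n \<Longrightarrow> (x, y) \<in> parcs (diamond i) \<Longrightarrow> \<bar>h x - h y\<bar> \<le> (1/2 + \<epsilon>) ^ i"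
  shows "\<bar>h u - h v\<bar> \<le> mdist (weighted_diamond \<epsilon> n) u v"
proof -
  let ?G = "weighted_diamond_graph n" and ?w = "weighted_diamond_weight \<epsilon>"
  interpret fin_digraph ?G by (rule fin_digraph_weighted_diamond_graph)
  have walk: "\<bar>h x - h y\<bar> \<le> awalk_cost ?w p" if "awalk x p y" for x p y
    using that
  proof (induction p arbitrary: x)
    case Nil then show ?case by (auto simp: awalk_Nil_iff)
  next
    case (Cons e p)
    obtain i b c where e: "e = (i, b, c)" by (cases e)
    have *: "e \<in> arcs ?G" "x = tail ?G e" "awalk (head ?G e) p y"
      using Cons.prems by (auto simp: awalk_Cons_iff)
    have b: "x = b" "head ?G e = c" "i \<le> n" "(b, c) \<in> parcs (diamond i)"
      using * e by (auto simp: weighted_diamond_graph_def)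
    have "\<bar>h x - h c\<bar> \<le> ?w e" using lip b e by (simp add: weighted_diamond_weight_def)
    moreover have "\<bar>h c - h y\<bar> \<le> awalk_cost ?w p" using Cons.IH * b by simp
    ultimately show ?case by simp
  qed
  have "?w e \<ge> 0" for e
    using assms(1) by (auto simp: weighted_diamond_weight_def split: prod.splits)
  then obtain p where "awalk u p v" "\<mu> ?w u v = awalk_cost ?w p"
    using min_cost_awalk[OF weighted_diamond_reachable[OF assms(2,3)], of ?w]
    by (auto simp: apath_def)
  then show ?thesis using walk[of u p v] by (simp add: weighted_diamond_simps[OF assms(1)])
qed

text \<open>
  A new vertex receives the average of the two values at the ends of the subdivided edge, which
  halves the differences.  For the weights \<open>(1/2 + \<epsilon>) ^ i\<close> this is enough, as they decrease by
  a factor of more than one half from one diamond to the next.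
\<close>

lemma extend_lipschitz_to_next_diamond:
  fixes h :: "dvertex \<Rightarrow> real"
  assumes lip: "\<And>x y. (x, y) \<in> parcs (diamond i) \<Longrightarrow> \<bar>h x - h y\<bar> \<le> 2 * t"
  obtains h' where "\<And>x. x \<in> pverts (diamond i) \<Longrightarrow> h' x = h x"
    "\<And>x y. (x, y) \<in> parcs (diamond (Suc i)) \<Longrightarrow> \<bar>h' x - h' y\<bar> \<le> t"
proof -
  have "\<exists>r. \<forall>u v s. z = New (Upair u v) s \<longrightarrow> r = (h u + h v) / 2" for z
  proof (cases "\<exists>u v s. z = New (Upair u v) s")
    case True
    then obtain u v s where z: "z = New (Upair u v) s" by blast
    show ?thesis by (rule exI[of _ "(h u + h v) / 2"]) (auto simp: z)
  qed auto
  then obtain m where "\<forall>z u v s. z = New (Upair u v) s \<longrightarrow> m z = (h u + h v) / 2"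
    by metis
  then have m: "m (New (Upair u v) s) = (h u + h v) / 2" for u v s by blast
  define h' where "h' x = (if x \<in> pverts (diamond i) then h x else m x)" for x
  have arc: "\<bar>h' u - h' (New (Upair u v) s)\<bar> \<le> t" if "(u, v) \<in> parcs (diamond i)" for u v s
    using lip[OF that] diamond_fresh[OF that, of s] diamond_arcs_verts[OF that]
    by (simp add: h'_def m abs_le_iff field_simps)
  show ?thesis
  proof (rule that)
    show "h' x = h x" if "x \<in> pverts (diamond i)" for x using that by (simp add: h'_def)
    show "\<bar>h' x - h' y\<bar> \<le> t" if "(x, y) \<in> parcs (diamond (Suc i))" for x y
      using that arc by (auto simp: abs_minus_commute)
  qed
qed

text \<open>
  Up to level \<open>i\<close> all edge weights are at least \<open>(1/2 + \<epsilon>) ^ i\<close>, so the function that vanishes at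
  \<open>x\<close> and takes this value elsewhere is a potential; it extends to all later levels.
\<close>

lemma weighted_diamond_dist_ge:
  assumes "0 < \<epsilon>" "\<epsilon> < 1/2" "i \<le> n"
    and x: "x \<in> pverts (diamond i)" and y: "y \<in> pverts (diamond i)" and "x \<noteq> y"
  shows "(1/2 + \<epsilon>) ^ i \<le> mdist (weighted_diamond \<epsilon> n) x y"
proof -
  let ?w = "1/2 + \<epsilon>"
  have ext: "\<exists>h. h x = 0 \<and> h y = ?w ^ i \<and>
      (\<forall>j u v. j \<le> k \<longrightarrow> (u, v) \<in> parcs (diamond j) \<longrightarrow> \<bar>h u - h v\<bar> \<le> ?w ^ j)" if "i \<le> k" for k
    using that
  proof (induction k rule: dec_induct)
    case base
    have "?w ^ i \<le> ?w ^ j" if "j \<le> i" for j using that assms by (intro power_decreasing) auto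
    moreover have "0 \<le> ?w ^ j" for j using assms by simp
    ultimately show ?case
      using \<open>x \<noteq> y\<close> by (intro exI[of _ "\<lambda>u. if u = x then 0 else ?w ^ i"]) auto
  next
    case (step k)
    then obtain h where h: "h x = 0" "h y = ?w ^ i"
      "\<And>j u v. j \<le> k \<Longrightarrow> (u, v) \<in> parcs (diamond j) \<Longrightarrow> \<bar>h u - h v\<bar> \<le> ?w ^ j"
      by blast
    have "?w ^ k \<le> 2 * ?w ^ Suc k" using assms by simp
    then have "\<bar>h u - h v\<bar> \<le> 2 * ?w ^ Suc k" if "(u, v) \<in> parcs (diamond k)" for u v
      using h(3)[of k u v] that by linarith
    then obtain h' where h': "\<And>u. u \<in> pverts (diamond k) \<Longrightarrow> h' u = h u"
      "\<And>u v. (u, v) \<in> parcs (diamond (Suc k)) \<Longrightarrow> \<bar>h' u - h' v\<bar> \<le> ?w ^ Suc k"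
      using extend_lipschitz_to_next_diamond[of k h "?w ^ Suc k"] by metis
    have "\<bar>h' u - h' v\<bar> \<le> ?w ^ j" if "j \<le> Suc k" "(u, v) \<in> parcs (diamond j)" for j u v
    proof (cases "j = Suc k")
      case True then show ?thesis using h'(2) that by blast
    next
      case False
      then have "j \<le> k" using that by simp
      then have "h' u = h u" "h' v = h v"
        using diamond_arcs_verts[OF that(2)] diamond_verts_mono[of j k] h'(1) by auto
      then show ?thesis using h(3) that(2) \<open>j \<le> k\<close> by simp
    qed
    moreover have "h' x = 0" "h' y = ?w ^ i"
      using h h'(1) x y diamond_verts_mono[OF step(1)] by auto
    ultimately show ?case by blast
  qed
  then obtain h where h: "h x = 0" "h y = ?w ^ i"
    "\<And>j u v. j \<le> n \<Longrightarrow> (u, v) \<in> parcs (diamond j) \<Longrightarrow> \<bar>h u - h v\<bar> \<le> ?w ^ j"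
    using assms(3) by blast
  have "\<bar>h x - h y\<bar> \<le> mdist (weighted_diamond \<epsilon> n) x y"
    using x y diamond_verts_mono[OF assms(3)] h(3) assms(1)
    by (intro weighted_diamond_lipschitz) auto
  then show ?thesis using h by simp
qed

lemma diamond_connected:
  "x \<in> pverts (diamond n) \<Longrightarrow> (Pole False, x) \<in> (parcs (diamond n))\<^sup>*"
proof (induction n arbitrary: x)
  case 0
  then show ?case by auto
next
  case (Suc n)
  have sub: "(parcs (diamond n))\<^sup>* \<subseteq> (parcs (diamond (Suc n)))\<^sup>*"
  proof (rule rtrancl_subset_rtrancl, clarify)
    fix u v assume uv: "(u, v) \<in> parcs (diamond n)"
    have "(u, New (Upair u v) False) \<in> parcs (diamond (Suc n))"
      using uv by auto
    moreover have "(New (Upair v u) False, v) \<in> parcs (diamond (Suc n))"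
      using diamond_arcs_sym[OF uv] by (auto simp del: Upair_inject)
    moreover have "Upair u v = Upair v u" by auto
    ultimately show "(u, v) \<in> (parcs (diamond (Suc n)))\<^sup>*"
      by (metis converse_rtrancl_into_rtrancl r_into_rtrancl)
  qed
  from Suc.prems consider "x \<in> pverts (diamond n)"
    | u v s where "x = New (Upair u v) s" "(u, v) \<in> parcs (diamond n)" by auto
  then show ?case
  proof cases
    case 1 then show ?thesis using Suc.IH sub by blast
  next
    case 2
    then have "(u, x) \<in> parcs (diamond (Suc n))" by auto
    moreover have "(Pole False, u) \<in> (parcs (diamond (Suc n)))\<^sup>*"
      using Suc.IH diamond_arcs_verts[OF 2(2)] sub by blast
    ultimately show ?thesis by (metis rtrancl_into_rtrancl)
  qed
qed

lemma weighted_diamond_chain: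
  assumes "0 < \<epsilon>" "p \<in> pverts (diamond n)" "q \<in> pverts (diamond n)"
  shows "(p, q) \<in> {(u, v). u \<in> pverts (diamond n) \<and> v \<in> pverts (diamond n) \<and>
    mdist (weighted_diamond \<epsilon> n) u v \<le> (1/2 + \<epsilon>) ^ n}\<^sup>*"
proof -
  have "sym (parcs (diamond n))" using diamond_arcs_sym by (intro symI)
  then have "(p, q) \<in> (parcs (diamond n))\<^sup>*"
    using diamond_connected[OF assms(2)] diamond_connected[OF assms(3)]
    by (meson rtrancl_trans sym_rtrancl symD)
  moreover have "parcs (diamond n) \<subseteq> {(u, v). u \<in> pverts (diamond n) \<and> v \<in> pverts (diamond n) \<and>
    mdist (weighted_diamond \<epsilon> n) u v \<le> (1/2 + \<epsilon>) ^ n}"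
    using diamond_arcs_verts weighted_diamond_dist_arc_le[OF assms(1) order_refl] by auto
  ultimately show ?thesis using rtrancl_mono by blast
qed

text \<open>Each edge at a pole is replaced by two edges at this pole.\<close>

lemma card_pole_neighbours:
  "card {v. (Pole False, v) \<in> parcs (diamond n)} = 2 ^ n"
proof (induction n)
  case 0
  have "{v. (Pole False, v) \<in> parcs (diamond 0)} = {Pole True}" by auto
  then show ?case by simp
next
  case (Suc n)
  let ?S = "{v. (Pole False, v) \<in> parcs (diamond n)}"
  have "{v. (Pole False, v) \<in> parcs (diamond (Suc n))}
      = (\<lambda>(v, s). New (Upair (Pole False) v) s) ` (?S \<times> UNIV)" by auto
  moreover have "inj_on (\<lambda>(v, s). New (Upair (Pole False) v) s) (?S \<times> UNIV)"
    by (auto simp: inj_on_def)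
  ultimately show ?case using Suc by (simp add: card_image card_cartesian_product)
qed


section \<open>Separated sets in Euclidean space\<close>

text \<open>
  Cut the cube of half side \<open>R * \<delta>\<close> around \<open>p\<close> into cells of side \<open>\<delta> / k\<close>.  Two points in one cell
  differ by less than \<open>\<delta> / k\<close> in each coordinate, hence by less than \<open>\<delta>\<close> in the sum norm, which
  dominates the Euclidean norm; so a \<open>\<delta>\<close>-separated set has at most one point in a cell.
  A volume argument would give a bound without \<open>k\<close> in the base, but this factor is harmless when
  \<open>k\<close> grows polylogarithmically.
\<close>

lemma card_separated_euclidean_le:
  assumes "k > 0" "\<delta> > 0" "R \<ge> 0"
    and ball: "\<And>x. x \<in> S \<Longrightarrow> mdist (euclidean_metric k) x p \<le> R * \<delta>"
    and sep: "\<And>x y. x \<in> S \<Longrightarrow> y \<in> S \<Longrightarrow> x \<noteq> y \<Longrightarrow> mdist (euclidean_metric k) x y \<ge> \<delta>"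
  shows "real (card S) \<le> (2 * real k * R + 2) ^ k"
proof -
  define cell where "cell x = restrict (\<lambda>j. \<lfloor>real k * (x j - p j) / \<delta>\<rfloor>) {..<k}" for x :: "nat \<Rightarrow> real"
  define I where "I = {\<lfloor>- (real k * R)\<rfloor>..\<lfloor>real k * R\<rfloor>}"
  have "cell x \<in> PiE {..<k} (\<lambda>_. I)" if x: "x \<in> S" for x
  proof
    fix j assume j: "j \<in> {..<k}"
    have "\<bar>x j - p j\<bar> \<le> L2_set (\<lambda>j. x j - p j) {..<k}"
      using member_le_L2_set[of "{..<k}" j "\<lambda>j. \<bar>x j - p j\<bar>"] j by (simp add: L2_set_def)
    also have "\<dots> \<le> R * \<delta>" using ball[OF x] by (simp add: euclidean_metric_simps)
    finally have "\<bar>x j - p j\<bar> / \<delta> \<le> R" using assms by (simp add: field_simps)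
    then have "real k * (\<bar>x j - p j\<bar> / \<delta>) \<le> real k * R" by (intro mult_left_mono) auto
    then have "\<bar>real k * (x j - p j) / \<delta>\<bar> \<le> real k * R"
      using assms by (simp add: abs_mult abs_divide)
    then have "- (real k * R) \<le> real k * (x j - p j) / \<delta>" "real k * (x j - p j) / \<delta> \<le> real k * R"
      by (simp_all only: abs_le_iff) linarith
    then show "cell x j \<in> I" using j by (auto simp: cell_def I_def intro: floor_mono)
  qed (auto simp: cell_def)
  then have img: "cell ` S \<subseteq> PiE {..<k} (\<lambda>_. I)" by blast
  have "inj_on cell S"
  proof (rule inj_onI, rule ccontr)
    fix x y assume xy: "x \<in> S" "y \<in> S" "cell x = cell y" "x \<noteq> y"
    have close: "\<bar>x j - y j\<bar> < \<delta> / k" if "j < k" for j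
    proof -
      have "\<lfloor>real k * (x j - p j) / \<delta>\<rfloor> = \<lfloor>real k * (y j - p j) / \<delta>\<rfloor>"
        using fun_cong[OF xy(3), of j] that by (simp add: cell_def)
      then have "\<bar>real k * (x j - p j) / \<delta> - real k * (y j - p j) / \<delta>\<bar> < 1" by linarith
      also have "real k * (x j - p j) / \<delta> - real k * (y j - p j) / \<delta> = real k / \<delta> * (x j - y j)"
        by (simp add: diff_divide_distrib algebra_simps)
      also have "\<bar>real k / \<delta> * (x j - y j)\<bar> = real k / \<delta> * \<bar>x j - y j\<bar>"
        using assms(2) by (simp add: abs_mult)
      finally show ?thesis using assms(1,2) by (simp add: field_simps)
    qed
    have "\<delta> \<le> L2_set (\<lambda>j. x j - y j) {..<k}" using sep xy by (simp add: euclidean_metric_simps)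
    also have "\<dots> \<le> (\<Sum>j<k. \<bar>x j - y j\<bar>)" by (rule L2_set_le_sum_abs)
    also have "\<dots> < (\<Sum>j<k. \<delta> / k)" using close assms(1) by (intro sum_strict_mono) auto
    finally show False using assms(1) by simp
  qed
  then have "card S \<le> card (PiE {..<k} (\<lambda>_. I))"
    using img by (intro card_inj_on_le) (auto simp: I_def intro!: finite_PiE)
  also have "\<dots> = card I ^ k" by (simp add: card_PiE)
  finally have "real (card S) \<le> real (card I) ^ k" by (metis of_nat_le_iff of_nat_power)
  also have "\<dots> \<le> (2 * real k * R + 2) ^ k"
  proof (rule power_mono)
    have "real k * R \<ge> 0" using assms by simp
    then show "real (card I) \<le> 2 * real k * R + 2" unfolding I_def by (simp, linarith)
  qed simp
  finally show ?thesis .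
qed


section \<open>Weighted diamonds in compositions\<close>

text \<open>
  An equilateral space cannot tell the long distance between the poles from the short one
  between a pole and a neighbour.  A Euclidean space of small dimension has no room for all the
  neighbours of a pole.
\<close>

lemma diamond_not_bilipschitz_in_factor:
  fixes M :: "'a metric"
  assumes "0 < \<epsilon>" "\<epsilon> < 1/2" "i \<le> n" "K \<ge> 1" "C \<ge> 1" "k > 0"
    and small: "K * (1/2 + \<epsilon>) ^ i < 1"
    and large: "(2 * real k * (C * K) + 2) ^ k < 2 ^ i"
    and M: "M \<in> equilateral_class \<union> euclidean_class k C"
  shows "\<not> bilipschitz_on K (pverts (diamond i)) (weighted_diamond \<epsilon> n) M g"
proof
  let ?W = "weighted_diamond \<epsilon> n" and ?w = "1/2 + \<epsilon>"
  let ?N = "{v. (Pole False, v) \<in> parcs (diamond i)}"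
  assume g: "bilipschitz_on K (pverts (diamond i)) ?W M g"
  have N: "?N \<subseteq> pverts (diamond i)" using diamond_arcs_verts by blast
  have near: "mdist ?W (Pole False) v \<le> ?w ^ i" if "v \<in> ?N" for v
    using that weighted_diamond_dist_arc_le[OF assms(1,3)] by blast
  have wpos: "?w ^ i > 0" using assms(1) by simp
  from M show False
  proof
    assume "M \<in> equilateral_class"
    then have "equilateral M" by (simp add: equilateral_class_def)
    then obtain r where r: "\<forall>x \<in> mspace M. \<forall>y \<in> mspace M. x \<noteq> y \<longrightarrow> mdist M x y = r"
      unfolding equilateral_def by blast
    obtain a where a: "g ` pverts (diamond i) \<subseteq> mspace M" "a > 0"
      "\<And>x y. x \<in> pverts (diamond i) \<Longrightarrow> y \<in> pverts (diamond i) \<Longrightarrow> a * mdist ?W x y \<le> mdist M (g x) (g y)"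
      "\<And>x y. x \<in> pverts (diamond i) \<Longrightarrow> y \<in> pverts (diamond i) \<Longrightarrow> mdist M (g x) (g y) \<le> K * a * mdist ?W x y"
      using g unfolding bilipschitz_on_def by blast
    have dist_r: "mdist M (g x) (g y) = r"
      if xy: "x \<in> pverts (diamond i)" "y \<in> pverts (diamond i)" "x \<noteq> y" for x y
    proof -
      have "0 < a * mdist ?W x y"
        using weighted_diamond_dist_ge[OF assms(1-3) xy] wpos a(2) by (intro mult_pos_pos) auto
      also have "\<dots> \<le> mdist M (g x) (g y)" by (rule a(3)[OF xy(1,2)])
      finally have "0 < mdist M (g x) (g y)" .
      moreover have "g x \<in> mspace M" "g y \<in> mspace M" using a(1) xy by auto
      ultimately show ?thesis using r by (metis less_irrefl mdist_zero)
    qed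
    have "?N \<noteq> {}" using card_pole_neighbours[of i] by (metis card.empty power_not_zero zero_neq_numeral)
    then obtain v where v: "v \<in> ?N" by blast
    have "a * 1 \<le> a * mdist ?W (Pole False) (Pole True)"
      using weighted_diamond_dist_ge[OF assms(1,2), of 0 n "Pole False" "Pole True"] a(2)
      by (intro mult_left_mono) auto
    also have "\<dots> \<le> r" using a(3)[of "Pole False" "Pole True"] dist_r[of "Pole False" "Pole True"]
      by (simp add: Pole_in_diamond)
    also have "r \<le> K * a * mdist ?W (Pole False) v"
      using a(4)[of "Pole False" v] dist_r[of "Pole False" v] v N diamond_arcs_neq[of "Pole False" v i]
      by (auto simp: Pole_in_diamond)
    also have "\<dots> \<le> K * a * ?w ^ i" using near[OF v] a(2) \<open>K \<ge> 1\<close> by (intro mult_left_mono) auto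
    also have "\<dots> = a * (K * ?w ^ i)" by simp
    also have "\<dots> < a * 1" using small a(2) by (intro mult_strict_left_mono) auto
    finally show False by simp
  next
    let ?E = "euclidean_metric k"
    assume "M \<in> euclidean_class k C"
    then have "embeds_with_distortion M ?E C" by (simp add: euclidean_class_def)
    moreover have "0 \<le> C" using \<open>C \<ge> 1\<close> by simp
    ultimately obtain e where "bilipschitz_on C (mspace M) M ?E e"
      by (rule embeds_with_distortion_imp_bilipschitz_on)
    from bilipschitz_on_compose[OF g this] have "bilipschitz_on (C * K) (pverts (diamond i)) ?W ?E (e \<circ> g)"
      using \<open>C \<ge> 1\<close> by simp
    then obtain a where a: "a > 0"
      "\<And>x y. x \<in> pverts (diamond i) \<Longrightarrow> y \<in> pverts (diamond i) \<Longrightarrow> a * mdist ?W x y \<le> mdist ?E ((e \<circ> g) x) ((e \<circ> g) y)"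
      "\<And>x y. x \<in> pverts (diamond i) \<Longrightarrow> y \<in> pverts (diamond i) \<Longrightarrow> mdist ?E ((e \<circ> g) x) ((e \<circ> g) y) \<le> C * K * a * mdist ?W x y"
      unfolding bilipschitz_on_def by blast
    define h where "h = e \<circ> g"
    have CK: "C * K \<ge> 0" using assms by simp
    have sep: "a * ?w ^ i \<le> mdist ?E (h x) (h y)" if xy: "x \<in> ?N" "y \<in> ?N" "x \<noteq> y" for x y
    proof -
      have "a * ?w ^ i \<le> a * mdist ?W x y"
        using weighted_diamond_dist_ge[OF assms(1-3), of x y] xy N a(1) by (intro mult_left_mono) auto
      also have "\<dots> \<le> mdist ?E (h x) (h y)" using a(2)[of x y] xy N unfolding h_def by auto
      finally show ?thesis .
    qed
    have ball: "mdist ?E (h x) (h (Pole False)) \<le> C * K * (a * ?w ^ i)" if x: "x \<in> ?N" for x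
    proof -
      have "mdist ?E (h x) (h (Pole False)) \<le> C * K * a * mdist ?W (Pole False) x"
        using a(3)[of x "Pole False"] x N Pole_in_diamond unfolding h_def by (auto simp: mdist_commute)
      also have "\<dots> \<le> C * K * a * ?w ^ i" using near[OF x] CK a(1) by (intro mult_left_mono) auto
      finally show ?thesis by (simp add: mult.assoc)
    qed
    have "a * ?w ^ i > 0" using a(1) wpos by simp
    have "inj_on h ?N"
    proof (rule inj_onI, rule ccontr)
      fix x y assume "x \<in> ?N" "y \<in> ?N" "h x = h y" "x \<noteq> y"
      then have "a * ?w ^ i \<le> mdist ?E (h x) (h x)" using sep[of x y] by simp
      then show False using \<open>a * ?w ^ i > 0\<close> by (simp add: euclidean_metric_simps L2_set_def)
    qed
    then have "card (h ` ?N) = 2 ^ i" using card_pole_neighbours[of i] by (simp add: card_image)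
    moreover have "real (card (h ` ?N)) \<le> (2 * real k * (C * K) + 2) ^ k"
      using sep ball \<open>a * ?w ^ i > 0\<close> CK \<open>k > 0\<close>
      by (intro card_separated_euclidean_le[where \<delta> = "a * ?w ^ i" and p = "h (Pole False)"]) auto
    ultimately show False using large by simp
  qed
qed

text \<open>
  The assumption \<open>small\<close> says that the points of the coarse diamond are further apart than
  \<open>K\<close> times the length of a step in the fine one, as needed to descend from a composition to its
  outer factor or to one of its clusters.
\<close>

lemma diamond_not_bilipschitz_in_comp_class:
  fixes V :: "'a metric"
  assumes "0 < \<epsilon>" "\<epsilon> < 1/2" "i \<le> n" "K \<ge> 1" "\<beta> \<ge> 1"
    and small: "K * (1/2 + \<epsilon>) ^ n < (1/2 + \<epsilon>) ^ i"
    and factor: "\<And>(M :: 'a metric) g. M \<in> \<M> \<Longrightarrow>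
       \<not> bilipschitz_on K (pverts (diamond i)) (weighted_diamond \<epsilon> n) M g"
    and V: "V \<in> comp_class \<beta> \<M>"
  shows "\<not> bilipschitz_on K (pverts (diamond n)) (weighted_diamond \<epsilon> n) V f"
  using V
proof (induction arbitrary: f rule: comp_class.induct)
  case (base V)
  then show ?case
    using factor bilipschitz_on_subset diamond_verts_mono[OF \<open>i \<le> n\<close>] by blast
next
  case (compose M \<beta>' S N V)
  let ?W = "weighted_diamond \<epsilon> n"
  show ?case
  proof
    assume f: "bilipschitz_on K (pverts (diamond n)) ?W V f"
    have "(\<exists>x \<in> mspace M. bilipschitz_on K (pverts (diamond n)) ?W (N x) f) \<or>
        (\<exists>g. bilipschitz_on K (pverts (diamond i)) ?W M g)"
    proof (rule bilipschitz_on_composition[OF compose.hyps(3) _ f])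
      show "\<beta>' \<ge> 1" "K \<ge> 0" using compose.hyps(2) assms by auto
      show "pverts (diamond n) \<noteq> {}" using Pole_in_diamond by blast
      show "pverts (diamond i) \<subseteq> pverts (diamond n)" by (rule diamond_verts_mono[OF \<open>i \<le> n\<close>])
      then show "pverts (diamond i) \<subseteq> mspace ?W" by (simp add: weighted_diamond_simps[OF \<open>0 < \<epsilon>\<close>])
      show "K * (1/2 + \<epsilon>) ^ n < mdist ?W p q"
        if "p \<in> pverts (diamond i)" "q \<in> pverts (diamond i)" "p \<noteq> q" for p q
        using small weighted_diamond_dist_ge[OF assms(1-3) that] by linarith
    qed (rule weighted_diamond_chain[OF \<open>0 < \<epsilon>\<close>])
    then show False
    proof (elim disjE bexE exE)
      fix x assume x: "x \<in> mspace M" and fx: "bilipschitz_on K (pverts (diamond n)) ?W (N x) f"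
      obtain e where "bilipschitz_on 1 (mspace (N x)) (N x) (S x) e"
        using compose.IH[OF x] isometric_imp_bilipschitz_on by blast
      from bilipschitz_on_compose[OF fx this] show False
        using compose.IH[OF x] by simp
    qed (use factor compose.hyps(1) in blast)
  qed
qed

text \<open>
  The logarithm of the left-hand side is of order \<open>(ln n)\<^sup>2 * ln (ln n)\<close>, that of the right-hand
  side is linear.
\<close>

lemma eventually_grid_count_less:
  fixes d :: "nat \<Rightarrow> nat"
  assumes "(\<lambda>n. real (d n)) \<in> O(\<lambda>n. (ln (real n))\<^sup>2)" "R \<ge> 0"
  shows "\<forall>\<^sub>F n in sequentially. (2 * real (d n) * R + 2) ^ d n < 2 ^ (n - c)"
proof -
  obtain A where A: "A > 0" "\<forall>\<^sub>F n in sequentially. norm (real (d n)) \<le> A * norm ((ln (real n))\<^sup>2)"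
    using assms(1) by (elim landau_o.bigE)
  have "\<forall>\<^sub>F n::nat in sequentially.
      (A * (ln (real n))\<^sup>2) * ln (2 * (A * (ln (real n))\<^sup>2) * (R + 1) + 2) < (real n - real c) * ln 2"
  proof -
    \<comment> \<open>With \<open>R + 1\<close> in place of \<open>R\<close>, the coefficient of the leading term is positive also
      for \<open>R = 0\<close>.\<close>
    have "R + 1 > 0" using assms(2) by simp
    then show ?thesis using A(1) by real_asymp
  qed
  with A(2) show ?thesis
    using eventually_ge_at_top[of c]
  proof eventually_elim
    case (elim n)
    let ?L = "A * (ln (real n))\<^sup>2"
    have dL: "real (d n) \<le> ?L" using elim(1) by simp
    have "2 * real (d n) * R \<le> 2 * ?L * (R + 1)"
      using dL assms(2) A(1) by (intro mult_mono) auto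
    then have le: "2 * real (d n) * R + 2 \<le> 2 * ?L * (R + 1) + 2" by simp
    have ge: "2 * real (d n) * R + 2 \<ge> 2" using assms(2) by simp
    have "ln (2 * real (d n) * R + 2) \<le> ln (2 * ?L * (R + 1) + 2)"
      by (subst ln_le_cancel_iff) (use le ge in linarith)+
    moreover have "0 \<le> ln (2 * real (d n) * R + 2)" by (rule ln_ge_zero) (use ge in linarith)
    ultimately have "real (d n) * ln (2 * real (d n) * R + 2) \<le> ?L * ln (2 * ?L * (R + 1) + 2)"
      using dL A(1) by (intro mult_mono) auto
    also have "\<dots> < real (n - c) * ln 2" using elim by (simp add: of_nat_diff)
    finally have "ln ((2 * real (d n) * R + 2) ^ d n) < ln (2 ^ (n - c))"
      using ge by (simp add: ln_realpow)
    moreover have "(2 * real (d n) * R + 2) ^ d n > 0" using ge by (intro zero_less_power) linarith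
    ultimately show ?case by (subst (asm) ln_less_cancel_iff) auto
  qed
qed

theorem theorem3p17:
  fixes C \<beta> \<epsilon> :: real and d :: "nat \<Rightarrow> nat"
  assumes "C \<ge> 1" and "\<beta> \<ge> 1" and "0 < \<epsilon>" and "\<epsilon> < 1/2"
    and "\<And>n. d n > 0"
    and "(\<lambda>n. real (d n)) \<in> O(\<lambda>n. (ln (real n))\<^sup>2)"
  shows "\<not> (\<exists>K::real. \<forall>n. \<exists>V :: 'a metric.
            V \<in> comp_class \<beta> (equilateral_class \<union> euclidean_class (d n) C) \<and>
            embeds_with_distortion (weighted_diamond \<epsilon> n) V K)"
proof
  assume "\<exists>K::real. \<forall>n. \<exists>V :: 'a metric.
            V \<in> comp_class \<beta> (equilateral_class \<union> euclidean_class (d n) C) \<and>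
            embeds_with_distortion (weighted_diamond \<epsilon> n) V K"
  then obtain K0 where K0: "\<And>n. \<exists>V :: 'a metric.
            V \<in> comp_class \<beta> (equilateral_class \<union> euclidean_class (d n) C) \<and>
            embeds_with_distortion (weighted_diamond \<epsilon> n) V K0" by blast
  define K where "K = max K0 1"
  have K: "K \<ge> 1" "ennreal K0 \<le> ennreal K" by (auto simp: K_def intro: ennreal_leI)
  let ?w = "1/2 + \<epsilon>"
  have w: "0 < ?w" "?w < 1" using assms by auto
  obtain c where "?w ^ c < 1 / K" using real_arch_pow_inv[of "1 / K" ?w] w K by auto
  then have c: "K * ?w ^ c < 1" using K by (simp add: field_simps)
  \<comment> \<open>From \<open>n \<ge> 2 * c\<close> on, \<open>n - c\<close> is at least \<open>c\<close>, so that neighbours in the coarse diamond are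
    closer than \<open>1 / K\<close>.\<close>
  have "\<forall>\<^sub>F n in sequentially. (2 * real (d n) * (C * K) + 2) ^ d n < 2 ^ (n - c) \<and> n \<ge> 2 * c"
    using eventually_grid_count_less[OF assms(6), of "C * K" c] assms(1) K
    by (intro eventually_conj eventually_ge_at_top) auto
  then obtain n where n: "(2 * real (d n) * (C * K) + 2) ^ d n < 2 ^ (n - c)" "n \<ge> 2 * c"
    by (auto simp: eventually_sequentially)
  let ?i = "n - c"
  obtain V :: "'a metric" where V: "V \<in> comp_class \<beta> (equilateral_class \<union> euclidean_class (d n) C)"
    "embeds_with_distortion (weighted_diamond \<epsilon> n) V K0" using K0 by blast
  then have "embeds_with_distortion (weighted_diamond \<epsilon> n) V K"
    using K(2) unfolding embeds_with_distortion_def by (meson order_trans)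
  then obtain f where f: "bilipschitz_on K (pverts (diamond n)) (weighted_diamond \<epsilon> n) V f"
    using embeds_with_distortion_imp_bilipschitz_on[of "weighted_diamond \<epsilon> n" V K] K(1)
    by (auto simp: weighted_diamond_simps[OF \<open>0 < \<epsilon>\<close>])
  have "K * ?w ^ ?i \<le> K * ?w ^ c"
    using n(2) w K(1) by (intro mult_left_mono power_decreasing) auto
  then have small: "K * ?w ^ ?i < 1" using c by simp
  have "?w ^ n = ?w ^ ?i * ?w ^ c" using n(2) by (simp flip: power_add)
  then have "K * ?w ^ n = ?w ^ ?i * (K * ?w ^ c)" by simp
  also have "\<dots> < ?w ^ ?i * 1" using c w by (intro mult_strict_left_mono) auto
  finally have "K * ?w ^ n < ?w ^ ?i" by simp
  moreover have "\<not> bilipschitz_on K (pverts (diamond ?i)) (weighted_diamond \<epsilon> n) M g"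
    if "M \<in> equilateral_class \<union> euclidean_class (d n) C" for M :: "'a metric" and g
    by (rule diamond_not_bilipschitz_in_factor[OF assms(3,4) diff_le_self K(1) assms(1,5) small n(1) that])
  ultimately have "\<not> bilipschitz_on K (pverts (diamond n)) (weighted_diamond \<epsilon> n) V f"
    using V(1) by (rule diamond_not_bilipschitz_in_comp_class[OF assms(3,4) diff_le_self K(1) assms(2)])
  then show False using f by blast
qed

end
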